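(* Let $\mathcal{X}\subset\mathbb{R}^n$ (state set) and $\mathcal{U}\subset\mathbb{R}^m$ (input set) be hybrid zonotopes, let $\mathbf{f}$ be a (nonlinear) function with values in $\mathbb{R}^n$ defined on $\mathcal{X}\times\mathcal{U}$, let $\boldsymbol{\pi}$ be a feed-forward neural network with non-piecewise linear activation functions such that $\boldsymbol{\pi}(\mathbf{x})\in\mathcal{U}$ for all $\mathbf{x}\in\mathcal{X}$, and let $\mathcal{T}=\langle \mathbf{G}^c_\tau,\mathbf{G}^b_\tau,\mathbf{c}_\tau,\mathbf{A}^c_\tau,\mathbf{A}^b_\tau,\mathbf{b}_\tau\rangle\subset\mathbb{R}^n$ be a target set represented by a hybrid zonotope. Let $\mathcal{H}_\pi=\{[\mathbf{x}^\top\ \mathbf{u}^\top]^\top\mid\mathbf{u}=\boldsymbol{\pi}(\mathbf{x}),\ \mathbf{x}\in\mathcal{X}\}$ and let $\overline{\mathcal{H}}_\pi=\langle \overline{\mathbf{G}}^c_\pi,\overline{\mathbf{G}}^b_\pi,\overline{\mathbf{c}}_\pi,\overline{\mathbf{A}}^c_\pi,\overline{\mathbf{A}}^b_\pi,\overline{\mathbf{b}}_\pi\rangle\subset\mathbb{R}^{n+m}$ be a hybrid zonotope over-approximating this graph set, $\overline{\mathcal{H}}_\pi\supseteq\mathcal{H}_\pi$. Let the prior sets $\mathcal{X}^p\subset\mathbb{R}^n$, $\mathcal{U}^p\subset\mathbb{R}^m$ satisfy $$\mathcal{H}_\pi\cap_{[\mathbf{I}_n\ \mathbf{0}]}\mathcal{P}(\mathcal{T})\subseteq\mathcal{X}^p\times\mathcal{U}^p\subseteq\mathcal{X}\times\mathcal{U},$$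 and let $\overline{\mathcal{H}}_f(\mathcal{X}^p,\mathcal{U}^p)=\langle \mathbf{G}^c_{fp},\mathbf{G}^b_{fp},\mathbf{c}_{fp},\mathbf{A}^c_{fp},\mathbf{A}^b_{fp},\mathbf{b}_{fp}\rangle\subset\mathbb{R}^{2n+m}$ be a hybrid zonotope over-approximation of the graph set of $\mathbf{f}$ over $\mathcal{X}^p\times\mathcal{U}^p$, i.e. containing $\{[\mathbf{x}^\top\ \mathbf{u}^\top\ \mathbf{y}^\top]^\top\mid\mathbf{y}=\mathbf{f}(\mathbf{x},\mathbf{u}),\ \mathbf{x}\in\mathcal{X}^p,\ \mathbf{u}\in\mathcal{U}^p\}$. Then the one-step backward reachable set $\mathcal{P}(\mathcal{T})$ of the closed-loop system $\mathbf{x}(t+1)=\mathbf{f}(\mathbf{x}(t),\boldsymbol{\pi}(\mathbf{x}(t)))$ is over-approximated by the hybrid zonotope $\langle \mathbf{G}^c_p,\mathbf{G}^b_p,\mathbf{c}_p,\mathbf{A}^c_p,\mathbf{A}^b_p,\mathbf{b}_p\rangle$, i.e. $\mathcal{P}(\mathcal{T})\subseteq\langle \mathbf{G}^c_p,\mathbf{G}^b_p,\mathbf{c}_p,\mathbf{A}^c_p,\mathbf{A}^b_p,\mathbf{b}_p\rangle$, where $\mathbf{c}_p=\overline{\mathbf{c}}_\pi[1:n,:]$, $\mathbf{G}^c_p=\begin{bmatrix}\overline{\mathbf{G}}^c_\pi[1:n,:]&\mathbf{0}&\mathbf{0}\end{bmatrix}$, $\mathbf{G}^b_p=\begin{bmatrix}\overline{\mathbf{G}}^b_\pi[1:n,:]&\mathbf{0}&\mathbf{0}\end{bmatrix}$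 and $$\mathbf{A}^c_p=\begin{bmatrix}\overline{\mathbf{A}}^c_\pi&\mathbf{0}&\mathbf{0}\\ \mathbf{0}&\mathbf{A}^c_{fp}&\mathbf{0}\\ \mathbf{0}&\mathbf{0}&\mathbf{A}^c_\tau\\ \overline{\mathbf{G}}^c_\pi&-\mathbf{G}^c_{fp}[1:n+m,:]&\mathbf{0}\\ \mathbf{0}&\mathbf{G}^c_{fp}[n+m+1:2n+m,:]&-\mathbf{G}^c_\tau\end{bmatrix},$$ $$\mathbf{A}^b_p=\begin{bmatrix}\overline{\mathbf{A}}^b_\pi&\mathbf{0}&\mathbf{0}\\ \mathbf{0}&\mathbf{A}^b_{fp}&\mathbf{0}\\ \mathbf{0}&\mathbf{0}&\mathbf{A}^b_\tau\\ \overline{\mathbf{G}}^b_\pi&-\mathbf{G}^b_{fp}[1:n+m,:]&\mathbf{0}\\ \mathbf{0}&\mathbf{G}^b_{fp}[n+m+1:2n+m,:]&-\mathbf{G}^b_\tau\end{bmatrix},\qquad \mathbf{b}_p=\begin{bmatrix}\overline{\mathbf{b}}_\pi\\ \mathbf{b}_{fp}\\ \mathbf{b}_\tau\\ \mathbf{c}_{fp}[1:n+m,:]-\overline{\mathbf{c}}_\pi\\ \mathbf{c}_\tau-\mathbf{c}_{fp}[n+m+1:2n+m,:]\end{bmatrix}.$$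
   Context: Hybrid zonotope: for $\mathbf{c}\in\mathbb{R}^{d}$, $\mathbf{G}^c\in\mathbb{R}^{d\times n_g}$, $\mathbf{G}^b\in\mathbb{R}^{d\times n_b}$, $\mathbf{A}^c\in\mathbb{R}^{n_c\times n_g}$, $\mathbf{A}^b\in\mathbb{R}^{n_c\times n_b}$, $\mathbf{b}\in\mathbb{R}^{n_c}$, $$\langle \mathbf{G}^c,\mathbf{G}^b,\mathbf{c},\mathbf{A}^c,\mathbf{A}^b,\mathbf{b}\rangle=\{\mathbf{G}^c\boldsymbol{\xi}^c+\mathbf{G}^b\boldsymbol{\xi}^b+\mathbf{c}\mid \boldsymbol{\xi}^c\in[-1,1]^{n_g},\ \boldsymbol{\xi}^b\in\{-1,1\}^{n_b},\ \mathbf{A}^c\boldsymbol{\xi}^c+\mathbf{A}^b\boldsymbol{\xi}^b=\mathbf{b}\}\subset\mathbb{R}^d.$$ A set is a hybrid zonotope if it is of this form (the numbers $n_g,n_b,n_c$ may differ from one hybrid zonotope to another). One-step backward reachable set: $\mathcal{P}(\mathcal{T})=\{\mathbf{x}\in\mathcal{X}\mid \mathbf{f}(\mathbf{x},\boldsymbol{\pi}(\mathbf{x}))\in\mathcal{T}\}$. Feed-forward neural network with $\ell$ layers, weights $\mathbf{W}^{(k-1)}$ and biases $\mathbf{v}^{(k-1)}$: $\mathbf{x}^{(0)}=\mathbf{x}$, $\mathbf{x}^{(k)}=\boldsymbol{\phi}(\mathbf{W}^{(k-1)}\mathbf{x}^{(k-1)}+\mathbf{v}^{(k-1)})$ for $k=1,\dots,\ell-1$,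 and $\boldsymbol{\pi}(\mathbf{x})=\mathbf{W}^{(\ell-1)}\mathbf{x}^{(\ell-1)}+\mathbf{v}^{(\ell-1)}$, where $\boldsymbol{\phi}$ applies a scalar activation function $\sigma$ (e.g. tanh, sigmoid) componentwise. Notation: generalized intersection $\mathcal{A}\cap_{\mathbf{R}}\mathcal{B}=\{\mathbf{z}\in\mathcal{A}\mid\mathbf{R}\mathbf{z}\in\mathcal{B}\}$; $\mathbf{A}[i:j,:]$ is the submatrix of rows $i$ through $j$ of $\mathbf{A}$ (also used for column vectors); $\mathbf{0}$ is a zero matrix of compatible size. *)

theory Defs
  imports Complex_Main "Jordan_Normal_Form.Matrix" "Jordan_Normal_Form.DL_Submatrix"
begin

text \<open>Elements of \<open>\<real>\<^sup>d\<close> are the members of \<^term>\<open>carrier_vec d :: real vec set\<close>; stacking of column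
  vectors is \<^term>\<open>append_vec\<close>, so that \<open>\<real>\<^sup>n \<times> \<real>\<^sup>m\<close> is identified with \<open>\<real>\<^bsup>n+m\<^esup>\<close>.\<close>

subsection \<open>Block matrices and row ranges\<close>

definition append_cols :: "'a :: zero mat \<Rightarrow> 'a mat \<Rightarrow> 'a mat" (infixr \<open>@\<^sub>c\<close> 67) where
  "A @\<^sub>c B = four_block_mat A B (0\<^sub>m 0 (dim_col A)) (0\<^sub>m 0 (dim_col B))"

text \<open>Row ranges are inclusive and count from 1, whereas library indices count from 0.\<close>

definition row_range :: "'a mat \<Rightarrow> nat \<Rightarrow> nat \<Rightarrow> 'a mat" (\<open>_[_:_,:]\<close> [1000, 0, 0] 1000) where
  "A[i:j,:] = submatrix A {i - 1..<j} UNIV"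

definition vec_range :: "'a vec \<Rightarrow> nat \<Rightarrow> nat \<Rightarrow> 'a vec" (\<open>_[_:_]\<^sub>v\<close> [1000, 0, 0] 1000) where
  "v[i:j]\<^sub>v = vec (j - (i - 1)) (\<lambda>k. v $ (i - 1 + k))"

lemma append_cols_carrier [simp, intro]:
  "A \<in> carrier_mat nr nc1 \<Longrightarrow> B \<in> carrier_mat nr nc2 \<Longrightarrow> A @\<^sub>c B \<in> carrier_mat nr (nc1 + nc2)"
  by (auto simp: append_cols_def)

lemma append_cols_index:
  assumes "A \<in> carrier_mat nr nc1" "B \<in> carrier_mat nr nc2" "i < nr" "j < nc1 + nc2"
  shows "(A @\<^sub>c B) $$ (i, j) = (if j < nc1 then A $$ (i, j) else B $$ (i, j - nc1))"
  using assms by (auto simp: append_cols_def)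

lemma pick_interval: "k < b - a \<Longrightarrow> pick {a..<b} k = a + k"
proof -
  assume k: "k < b - a"
  have "{x \<in> {a..<b}. x < a + k} = {a..<a + k}" using k by auto
  then have "card {x \<in> {a..<b}. x < a + k} = k" by simp
  moreover have "a + k \<in> {a..<b}" using k by auto
  ultimately show ?thesis by (metis pick_card_in_set)
qed

lemma row_range_eq:
  assumes "j \<le> dim_row A"
  shows "A[i:j,:] = mat (j - (i - 1)) (dim_col A) (\<lambda>(k, l). A $$ (i - 1 + k, l))"
proof -
  have "{k. k < dim_row A \<and> k \<in> {i - 1..<j}} = {i - 1..<j}" using assms by auto
  then have "card {k. k < dim_row A \<and> k \<in> {i - 1..<j}} = j - (i - 1)" by simp
  then show ?thesis
    unfolding row_range_def submatrix_def
    by (intro eq_matI) (auto simp: pick_interval pick_UNIV)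
qed

subsection \<open>Hybrid zonotopes\<close>

definition hz_format :: "nat \<Rightarrow> nat \<Rightarrow> nat \<Rightarrow> nat \<Rightarrow>
    real mat \<Rightarrow> real mat \<Rightarrow> real vec \<Rightarrow> real mat \<Rightarrow> real mat \<Rightarrow> real vec \<Rightarrow> bool" where
  "hz_format d ng nb nc Gc Gb c Ac Ab b \<longleftrightarrow>
     Gc \<in> carrier_mat d ng \<and> Gb \<in> carrier_mat d nb \<and> c \<in> carrier_vec d \<and>
     Ac \<in> carrier_mat nc ng \<and> Ab \<in> carrier_mat nc nb \<and> b \<in> carrier_vec nc"

definition hybrid_zonotope ::
    "real mat \<Rightarrow> real mat \<Rightarrow> real vec \<Rightarrow> real mat \<Rightarrow> real mat \<Rightarrow> real vec \<Rightarrow> real vec set" where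
  "hybrid_zonotope Gc Gb c Ac Ab b =
     {Gc *\<^sub>v \<xi>c + Gb *\<^sub>v \<xi>b + c | \<xi>c \<xi>b.
        \<xi>c \<in> carrier_vec (dim_col Gc) \<and> (\<forall>i<dim_col Gc. \<xi>c $ i \<in> {-1..1}) \<and>
        \<xi>b \<in> carrier_vec (dim_col Gb) \<and> (\<forall>i<dim_col Gb. \<xi>b $ i \<in> {-1, 1}) \<and>
        Ac *\<^sub>v \<xi>c + Ab *\<^sub>v \<xi>b = b}"

definition is_hybrid_zonotope :: "nat \<Rightarrow> real vec set \<Rightarrow> bool" where
  "is_hybrid_zonotope d S \<longleftrightarrow>
     (\<exists>ng nb nc Gc Gb c Ac Ab b.
        hz_format d ng nb nc Gc Gb c Ac Ab b \<and> S = hybrid_zonotope Gc Gb c Ac Ab b)"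

subsection \<open>Set operations\<close>

definition vec_times :: "'a vec set \<Rightarrow> 'a vec set \<Rightarrow> 'a vec set" (infixr \<open>\<times>\<^sub>v\<close> 80) where
  "A \<times>\<^sub>v B = {x @\<^sub>v u | x u. x \<in> A \<and> u \<in> B}"

definition gen_inter :: "real mat \<Rightarrow> real vec set \<Rightarrow> real vec set \<Rightarrow> real vec set" where
  "gen_inter R A B = {z \<in> A. R *\<^sub>v z \<in> B}"

subsection \<open>Feed-forward neural networks\<close>

fun ffnn_state :: "(real \<Rightarrow> real) \<Rightarrow> (nat \<Rightarrow> real mat) \<Rightarrow> (nat \<Rightarrow> real vec) \<Rightarrow> real vec \<Rightarrow> nat \<Rightarrow> real vec"
  where
  "ffnn_state \<sigma> W v x 0 = x"
| "ffnn_state \<sigma> W v x (Suc k) = map_vec \<sigma> (W k *\<^sub>v ffnn_state \<sigma> W v x k + v k)"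

definition ffnn :: "(real \<Rightarrow> real) \<Rightarrow> nat \<Rightarrow> (nat \<Rightarrow> real mat) \<Rightarrow> (nat \<Rightarrow> real vec) \<Rightarrow> real vec \<Rightarrow> real vec"
  where
  "ffnn \<sigma> l W v x = W (l - 1) *\<^sub>v ffnn_state \<sigma> W v x (l - 1) + v (l - 1)"

text \<open>\<open>N k\<close> is the width of layer \<open>k\<close>; layer 0 is the input and layer \<open>l\<close> the output.\<close>

definition ffnn_format ::
    "nat \<Rightarrow> nat \<Rightarrow> nat \<Rightarrow> (nat \<Rightarrow> nat) \<Rightarrow> (nat \<Rightarrow> real mat) \<Rightarrow> (nat \<Rightarrow> real vec) \<Rightarrow> bool" where
  "ffnn_format n m l N W v \<longleftrightarrow>
     1 \<le> l \<and> N 0 = n \<and> N l = m \<and>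
     (\<forall>k<l. W k \<in> carrier_mat (N (Suc k)) (N k) \<and> v k \<in> carrier_vec (N (Suc k)))"

text \<open>Finitely many breakpoints; the function is affine on every interval avoiding them, with no
  condition on its values at the breakpoints. (The connected subsets of \<open>\<real>\<close> are the intervals.)\<close>

definition piecewise_linear :: "(real \<Rightarrow> real) \<Rightarrow> bool" where
  "piecewise_linear \<sigma> \<longleftrightarrow>
     (\<exists>S. finite S \<and> (\<forall>I. connected I \<and> I \<inter> S = {} \<longrightarrow> (\<exists>a b. \<forall>t\<in>I. \<sigma> t = a * t + b)))"

subsection \<open>Graph sets and backward reachable sets\<close>

definition policy_graph :: "(real vec \<Rightarrow> real vec) \<Rightarrow> real vec set \<Rightarrow> real vec set" where
  "policy_graph \<pi> X = {x @\<^sub>v u | x u. u = \<pi> x \<and> x \<in> X}"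

definition dynamics_graph ::
    "(real vec \<Rightarrow> real vec \<Rightarrow> real vec) \<Rightarrow> real vec set \<Rightarrow> real vec set \<Rightarrow> real vec set" where
  "dynamics_graph f X U = {x @\<^sub>v u @\<^sub>v y | x u y. y = f x u \<and> x \<in> X \<and> u \<in> U}"

definition backward_reach :: "real vec set \<Rightarrow> (real vec \<Rightarrow> real vec \<Rightarrow> real vec) \<Rightarrow>
    (real vec \<Rightarrow> real vec) \<Rightarrow> real vec set \<Rightarrow> real vec set" where
  "backward_reach X f \<pi> T = {x \<in> X. f x (\<pi> x) \<in> T}"

end

theory Submission
  imports Defs
begin

text \<open>A state \<open>x\<close> of the backward reachable set determines the input \<open>u = \<pi> x\<close> and the successor
  \<open>y = f x u\<close>, and each of the three over-approximating sets contains one view of the triple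
  \<open>(x, u, y)\<close>: the policy graph contains \<open>(x, u)\<close>, the target contains \<open>y\<close>, and the dynamics graph
  contains \<open>(x, u, y)\<close>. The last of these is where the prior sets enter. Since \<open>x\<close> lies in the backward
  reachable set, the generalized intersection contains \<open>(x, u)\<close>, so \<open>x \<in> Xp\<close> and \<open>u \<in> Up\<close>, and
  hence restricting the dynamics graph to the prior sets loses no triple of interest.

  The three memberships supply three independent pairs of factors. Stacking them gives factors for
  the hybrid zonotope of the theorem: the first three row blocks of its constraint are the
  constraints of the three sets, the fourth says that the policy graph and the dynamics graph
  describe the same \<open>(x, u)\<close>, and the fifth that the dynamics graph and the target describe the same
  \<open>y\<close>. The generators and the center keep only
  the first \<open>n\<close> rows of those of the policy graph, which reads off \<open>x\<close>.

  The continuous and the binary constraint matrices are built from their ingredients in the same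
  way, so one construction (\<open>coupling_matrix\<close>) and one product formula (\<open>coupling_matrix_mult_vec\<close>)
  serve both. \<open>coupled_hybrid_zonotope_member\<close> is the stacking argument, free of any reachability
  context.\<close>

section \<open>Block matrices acting on stacked vectors\<close>

lemma append_vec_assoc: "(u @\<^sub>v v) @\<^sub>v w = u @\<^sub>v v @\<^sub>v w"
  by (intro eq_vecI) auto

lemma append_cols_mult_vec:
  fixes A B :: "'a :: comm_ring_1 mat"
  assumes A: "A \<in> carrier_mat nr nc1" and B: "B \<in> carrier_mat nr nc2"
    and x: "x \<in> carrier_vec nc1" and y: "y \<in> carrier_vec nc2"
  shows "(A @\<^sub>c B) *\<^sub>v (x @\<^sub>v y) = A *\<^sub>v x + B *\<^sub>v y"
proof -
  have "(A @\<^sub>c B) *\<^sub>v (x @\<^sub>v y)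
      = (A *\<^sub>v x + B *\<^sub>v y) @\<^sub>v (0\<^sub>m 0 nc1 *\<^sub>v x + 0\<^sub>m 0 nc2 *\<^sub>v y)"
    using A B four_block_mat_mult_vec[OF A B zero_carrier_mat zero_carrier_mat x y]
    by (simp add: append_cols_def)
  also have "\<dots> = A *\<^sub>v x + B *\<^sub>v y"
    using A B x y by (intro eq_vecI) auto
  finally show ?thesis .
qed

lemma append_cols3_mult_vec:
  fixes A B C :: "'a :: comm_ring_1 mat"
  assumes "A \<in> carrier_mat nr nc1" "B \<in> carrier_mat nr nc2" "C \<in> carrier_mat nr nc3"
    and "x \<in> carrier_vec nc1" "y \<in> carrier_vec nc2" "z \<in> carrier_vec nc3"
  shows "(A @\<^sub>c B @\<^sub>c C) *\<^sub>v (x @\<^sub>v y @\<^sub>v z) = A *\<^sub>v x + (B *\<^sub>v y + C *\<^sub>v z)"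
  using assms by (simp add: append_cols_mult_vec[of _ nr nc1 _ "nc2 + nc3"]
      append_cols_mult_vec[of _ nr nc2 _ nc3])

lemma zero_mat_mult_vec:
  "x \<in> carrier_vec nc \<Longrightarrow> 0\<^sub>m nr nc *\<^sub>v x = (0\<^sub>v nr :: 'a :: semiring_0 vec)"
  by (intro eq_vecI) auto

section \<open>Row ranges\<close>

lemma row_range_carrier:
  assumes "A \<in> carrier_mat nr nc" "j \<le> nr" "d = j - (i - 1)"
  shows "A[i:j,:] \<in> carrier_mat d nc"
  using assms by (simp add: row_range_eq)

lemma vec_range_carrier: "d = j - (i - 1) \<Longrightarrow> v[i:j]\<^sub>v \<in> carrier_vec d"
  by (simp add: vec_range_def)

lemma row_range_mult_vec:
  assumes A: "A \<in> carrier_mat nr nc" and j: "j \<le> nr" and x: "x \<in> carrier_vec nc"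
  shows "A[i:j,:] *\<^sub>v x = (A *\<^sub>v x)[i:j]\<^sub>v"
proof (intro eq_vecI)
  fix k assume "k < dim_vec ((A *\<^sub>v x)[i:j]\<^sub>v)"
  then have k: "k < j - (i - 1)" by (simp add: vec_range_def)
  then have "i - 1 + k < nr" using j by linarith
  then show "(A[i:j,:] *\<^sub>v x) $ k = (A *\<^sub>v x)[i:j]\<^sub>v $ k"
    using A j x k by (auto simp: row_range_eq vec_range_def scalar_prod_def)
qed (use A j in \<open>simp add: row_range_eq vec_range_def\<close>)

lemma vec_range_add3:
  assumes "u \<in> carrier_vec d" "v \<in> carrier_vec d" "w \<in> carrier_vec d" "j \<le> d"
  shows "(u + v + w)[i:j]\<^sub>v = u[i:j]\<^sub>v + v[i:j]\<^sub>v + w[i:j]\<^sub>v"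
  using assms by (intro eq_vecI) (auto simp: vec_range_def)

lemma vec_range_append_first:
  "v \<in> carrier_vec d \<Longrightarrow> (v @\<^sub>v w)[1:d]\<^sub>v = v"
  by (intro eq_vecI) (auto simp: vec_range_def)

lemma vec_range_append_last:
  "v \<in> carrier_vec d \<Longrightarrow> w \<in> carrier_vec (e - d) \<Longrightarrow> (v @\<^sub>v w)[d + 1:e]\<^sub>v = w"
  by (intro eq_vecI) (auto simp: vec_range_def)

section \<open>Membership in a hybrid zonotope\<close>

definition factor_vec :: "'a set \<Rightarrow> nat \<Rightarrow> 'a vec \<Rightarrow> bool" where
  "factor_vec S k \<xi> \<longleftrightarrow> \<xi> \<in> carrier_vec k \<and> (\<forall>i<k. \<xi> $ i \<in> S)"

lemma factor_vec_append:
  assumes "factor_vec S k \<xi>" "factor_vec S l \<eta>"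
  shows "factor_vec S (k + l) (\<xi> @\<^sub>v \<eta>)"
  using assms unfolding factor_vec_def by auto

lemma hybrid_zonotope_iff:
  assumes "hz_format d ng nb nc Gc Gb c Ac Ab b"
  shows "z \<in> hybrid_zonotope Gc Gb c Ac Ab b \<longleftrightarrow>
    (\<exists>\<xi>c \<xi>b. factor_vec {-1..1} ng \<xi>c \<and> factor_vec {-1, 1} nb \<xi>b \<and>
       Ac *\<^sub>v \<xi>c + Ab *\<^sub>v \<xi>b = b \<and> z = Gc *\<^sub>v \<xi>c + Gb *\<^sub>v \<xi>b + c)"
proof -
  have "dim_col Gc = ng" "dim_col Gb = nb" using assms by (auto simp: hz_format_def)
  then show ?thesis unfolding hybrid_zonotope_def factor_vec_def mem_Collect_eq by blast
qed

section \<open>Coupling three hybrid zonotopes\<close>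

text \<open>The block shape shared by the continuous and the binary constraint matrix of the coupled
  hybrid zonotope. The arguments \<open>A1 A2 A3\<close> and \<open>G1 G2 G3\<close> are the constraint and generator matrices
  of the sets that hold \<open>(x, u)\<close>, \<open>(x, u, y)\<close> and \<open>y\<close>, in this order.\<close>

definition coupling_matrix :: "nat \<Rightarrow> nat \<Rightarrow> real mat \<Rightarrow> real mat \<Rightarrow> real mat \<Rightarrow>
    real mat \<Rightarrow> real mat \<Rightarrow> real mat \<Rightarrow> real mat" where
  "coupling_matrix n m A1 A2 A3 G1 G2 G3 =
     (A1 @\<^sub>c 0\<^sub>m (dim_row A1) (dim_col A2) @\<^sub>c 0\<^sub>m (dim_row A1) (dim_col A3)) @\<^sub>r
     (0\<^sub>m (dim_row A2) (dim_col A1) @\<^sub>c A2 @\<^sub>c 0\<^sub>m (dim_row A2) (dim_col A3)) @\<^sub>r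
     (0\<^sub>m (dim_row A3) (dim_col A1) @\<^sub>c 0\<^sub>m (dim_row A3) (dim_col A2) @\<^sub>c A3) @\<^sub>r
     (G1 @\<^sub>c (- G2[1 : n + m,:]) @\<^sub>c 0\<^sub>m (n + m) (dim_col A3)) @\<^sub>r
     (0\<^sub>m n (dim_col A1) @\<^sub>c G2[n + m + 1 : 2 * n + m,:] @\<^sub>c (- G3))"

context
  fixes n m k1 k2 k3 r1 r2 r3 :: nat and A1 A2 A3 G1 G2 G3 :: "real mat"
  assumes A: "A1 \<in> carrier_mat r1 k1" "A2 \<in> carrier_mat r2 k2" "A3 \<in> carrier_mat r3 k3"
    and G: "G1 \<in> carrier_mat (n + m) k1" "G2 \<in> carrier_mat (2 * n + m) k2" "G3 \<in> carrier_mat n k3"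
begin

private lemma G2_top: "G2[1 : n + m,:] \<in> carrier_mat (n + m) k2"
  by (rule row_range_carrier[OF G(2)]) auto

private lemma G2_bottom: "G2[n + m + 1 : 2 * n + m,:] \<in> carrier_mat n k2"
  by (rule row_range_carrier[OF G(2)]) auto

private lemma coupling_rows:
  shows "A1 @\<^sub>c 0\<^sub>m r1 k2 @\<^sub>c 0\<^sub>m r1 k3 \<in> carrier_mat r1 (k1 + (k2 + k3))"
    and "0\<^sub>m r2 k1 @\<^sub>c A2 @\<^sub>c 0\<^sub>m r2 k3 \<in> carrier_mat r2 (k1 + (k2 + k3))"
    and "0\<^sub>m r3 k1 @\<^sub>c 0\<^sub>m r3 k2 @\<^sub>c A3 \<in> carrier_mat r3 (k1 + (k2 + k3))"
    and "G1 @\<^sub>c (- G2[1 : n + m,:]) @\<^sub>c 0\<^sub>m (n + m) k3 \<in> carrier_mat (n + m) (k1 + (k2 + k3))"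
    and "0\<^sub>m n k1 @\<^sub>c G2[n + m + 1 : 2 * n + m,:] @\<^sub>c (- G3) \<in> carrier_mat n (k1 + (k2 + k3))"
  using A G G2_top G2_bottom by (auto intro!: append_cols_carrier)

private lemma coupling_matrix_eq:
  "coupling_matrix n m A1 A2 A3 G1 G2 G3 =
     (A1 @\<^sub>c 0\<^sub>m r1 k2 @\<^sub>c 0\<^sub>m r1 k3) @\<^sub>r
     (0\<^sub>m r2 k1 @\<^sub>c A2 @\<^sub>c 0\<^sub>m r2 k3) @\<^sub>r
     (0\<^sub>m r3 k1 @\<^sub>c 0\<^sub>m r3 k2 @\<^sub>c A3) @\<^sub>r
     (G1 @\<^sub>c (- G2[1 : n + m,:]) @\<^sub>c 0\<^sub>m (n + m) k3) @\<^sub>r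
     (0\<^sub>m n k1 @\<^sub>c G2[n + m + 1 : 2 * n + m,:] @\<^sub>c (- G3))"
  using A unfolding coupling_matrix_def by auto

lemma coupling_matrix_carrier:
  "coupling_matrix n m A1 A2 A3 G1 G2 G3
     \<in> carrier_mat (r1 + (r2 + (r3 + (n + m + n)))) (k1 + (k2 + k3))"
  unfolding coupling_matrix_eq by (intro carrier_append_rows coupling_rows)

lemma coupling_matrix_mult_vec:
  assumes v: "v1 \<in> carrier_vec k1" "v2 \<in> carrier_vec k2" "v3 \<in> carrier_vec k3"
  shows "coupling_matrix n m A1 A2 A3 G1 G2 G3 *\<^sub>v (v1 @\<^sub>v v2 @\<^sub>v v3) =
    A1 *\<^sub>v v1 @\<^sub>v A2 *\<^sub>v v2 @\<^sub>v A3 *\<^sub>v v3 @\<^sub>v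
    (G1 *\<^sub>v v1 - (G2 *\<^sub>v v2)[1 : n + m]\<^sub>v) @\<^sub>v
    ((G2 *\<^sub>v v2)[n + m + 1 : 2 * n + m]\<^sub>v - G3 *\<^sub>v v3)"
proof -
  let ?v = "v1 @\<^sub>v v2 @\<^sub>v v3"
  have vc: "?v \<in> carrier_vec (k1 + (k2 + k3))" using v by simp
  have p: "A1 *\<^sub>v v1 \<in> carrier_vec r1" "A2 *\<^sub>v v2 \<in> carrier_vec r2" "A3 *\<^sub>v v3 \<in> carrier_vec r3"
      "G1 *\<^sub>v v1 \<in> carrier_vec (n + m)" "G3 *\<^sub>v v3 \<in> carrier_vec n"
    using A G v by auto
  have q: "(G2 *\<^sub>v v2)[1 : n + m]\<^sub>v \<in> carrier_vec (n + m)"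
      "(G2 *\<^sub>v v2)[n + m + 1 : 2 * n + m]\<^sub>v \<in> carrier_vec n"
    by (auto intro!: vec_range_carrier)
  have top: "G2[1 : n + m,:] *\<^sub>v v2 = (G2 *\<^sub>v v2)[1 : n + m]\<^sub>v"
    by (rule row_range_mult_vec[OF G(2) _ v(2)]) simp
  have bottom: "G2[n + m + 1 : 2 * n + m,:] *\<^sub>v v2 = (G2 *\<^sub>v v2)[n + m + 1 : 2 * n + m]\<^sub>v"
    by (rule row_range_mult_vec[OF G(2) _ v(2)]) simp
  have neg: "- G2[1 : n + m,:] *\<^sub>v v2 = - (G2 *\<^sub>v v2)[1 : n + m]\<^sub>v"
      "- G3 *\<^sub>v v3 = - (G3 *\<^sub>v v3)"
    unfolding top[symmetric] using G2_top G v by auto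
  have "(A1 @\<^sub>c 0\<^sub>m r1 k2 @\<^sub>c 0\<^sub>m r1 k3) *\<^sub>v ?v = A1 *\<^sub>v v1"
    using A v p by (subst append_cols3_mult_vec[OF _ _ _ v]) (auto simp: zero_mat_mult_vec)
  moreover have "(0\<^sub>m r2 k1 @\<^sub>c A2 @\<^sub>c 0\<^sub>m r2 k3) *\<^sub>v ?v = A2 *\<^sub>v v2"
    using A v p by (subst append_cols3_mult_vec[OF _ _ _ v]) (auto simp: zero_mat_mult_vec)
  moreover have "(0\<^sub>m r3 k1 @\<^sub>c 0\<^sub>m r3 k2 @\<^sub>c A3) *\<^sub>v ?v = A3 *\<^sub>v v3"
    using A v p by (subst append_cols3_mult_vec[OF _ _ _ v]) (auto simp: zero_mat_mult_vec)
  moreover have "(G1 @\<^sub>c (- G2[1 : n + m,:]) @\<^sub>c 0\<^sub>m (n + m) k3) *\<^sub>v ?v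
      = G1 *\<^sub>v v1 - (G2 *\<^sub>v v2)[1 : n + m]\<^sub>v"
  proof -
    have "(G1 @\<^sub>c (- G2[1 : n + m,:]) @\<^sub>c 0\<^sub>m (n + m) k3) *\<^sub>v ?v
        = G1 *\<^sub>v v1 + (- (G2 *\<^sub>v v2)[1 : n + m]\<^sub>v + 0\<^sub>v (n + m))"
      using G G2_top v
      by (subst append_cols3_mult_vec[OF _ _ _ v]) (simp_all only: zero_mat_mult_vec neg, auto)
    then show ?thesis using p q by (auto intro!: eq_vecI)
  qed
  moreover have "(0\<^sub>m n k1 @\<^sub>c G2[n + m + 1 : 2 * n + m,:] @\<^sub>c (- G3)) *\<^sub>v ?v
      = (G2 *\<^sub>v v2)[n + m + 1 : 2 * n + m]\<^sub>v - G3 *\<^sub>v v3"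
  proof -
    have "(0\<^sub>m n k1 @\<^sub>c G2[n + m + 1 : 2 * n + m,:] @\<^sub>c (- G3)) *\<^sub>v ?v
        = 0\<^sub>v n + ((G2 *\<^sub>v v2)[n + m + 1 : 2 * n + m]\<^sub>v + - (G3 *\<^sub>v v3))"
      using G G2_bottom v
      by (subst append_cols3_mult_vec[OF _ _ _ v])
        (simp_all only: zero_mat_mult_vec bottom neg, auto)
    then show ?thesis using p q by (auto intro!: eq_vecI)
  qed
  moreover note rows45 = carrier_append_rows[OF coupling_rows(4,5)]
  moreover note rows345 = carrier_append_rows[OF coupling_rows(3) rows45]
  moreover note rows2345 = carrier_append_rows[OF coupling_rows(2) rows345]
  ultimately show ?thesis
    unfolding coupling_matrix_eq
    by (simp only: mat_mult_append[OF coupling_rows(1) rows2345 vc]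
        mat_mult_append[OF coupling_rows(2) rows345 vc] mat_mult_append[OF coupling_rows(3) rows45 vc]
        mat_mult_append[OF coupling_rows(4,5) vc])
qed

end

text \<open>This is how a linking row block expresses that two representations agree: generator terms, which
  depend on the factors, go to the left, and centers to the right-hand side of the constraint.\<close>

lemma affine_images_agree:
  fixes c :: "real vec"
  assumes "pc \<in> carrier_vec k" "pb \<in> carrier_vec k" "c \<in> carrier_vec k"
    and "qc \<in> carrier_vec k" "qb \<in> carrier_vec k" "d \<in> carrier_vec k"
    and eq: "pc + pb + c = qc + qb + d"
  shows "(pc - qc) + (pb - qb) = d - c"
proof (intro eq_vecI)
  fix i assume "i < dim_vec (d - c)"
  then have i: "i < k" using assms by simp
  then have "(pc + pb + c) $ i = (qc + qb + d) $ i" by (simp only: eq)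
  then show "((pc - qc) + (pb - qb)) $ i = (d - c) $ i" using assms(1-6) i by simp
qed (use assms in simp)

context
  fixes n m :: nat
    and ng1 nb1 nc1 ng2 nb2 nc2 ng3 nb3 nc3 :: nat
    and Gc1 Gb1 Ac1 Ab1 Gc2 Gb2 Ac2 Ab2 Gc3 Gb3 Ac3 Ab3 :: "real mat"
    and c1 b1 c2 b2 c3 b3 :: "real vec"
  assumes format1: "hz_format (n + m) ng1 nb1 nc1 Gc1 Gb1 c1 Ac1 Ab1 b1"
    and format2: "hz_format (2 * n + m) ng2 nb2 nc2 Gc2 Gb2 c2 Ac2 Ab2 b2"
    and format3: "hz_format n ng3 nb3 nc3 Gc3 Gb3 c3 Ac3 Ab3 b3"
begin

private lemmas carriers =
  format1[unfolded hz_format_def] format2[unfolded hz_format_def] format3[unfolded hz_format_def]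

lemma coupled_hybrid_zonotope_format:
  "hz_format n (ng1 + ng2 + ng3) (nb1 + nb2 + nb3) (nc1 + nc2 + nc3 + (n + m) + n)
     (Gc1[1 : n,:] @\<^sub>c 0\<^sub>m n ng2 @\<^sub>c 0\<^sub>m n ng3) (Gb1[1 : n,:] @\<^sub>c 0\<^sub>m n nb2 @\<^sub>c 0\<^sub>m n nb3) (c1[1 : n]\<^sub>v)
     (coupling_matrix n m Ac1 Ac2 Ac3 Gc1 Gc2 Gc3) (coupling_matrix n m Ab1 Ab2 Ab3 Gb1 Gb2 Gb3)
     (b1 @\<^sub>v b2 @\<^sub>v b3 @\<^sub>v (c2[1 : n + m]\<^sub>v - c1) @\<^sub>v (c3 - c2[n + m + 1 : 2 * n + m]\<^sub>v))"
proof -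
  have "Gc1[1 : n,:] \<in> carrier_mat n ng1" "Gb1[1 : n,:] \<in> carrier_mat n nb1"
    using carriers by (auto intro!: row_range_carrier[of _ "n + m"])
  then have "Gc1[1 : n,:] @\<^sub>c 0\<^sub>m n ng2 @\<^sub>c 0\<^sub>m n ng3 \<in> carrier_mat n (ng1 + (ng2 + ng3))"
      "Gb1[1 : n,:] @\<^sub>c 0\<^sub>m n nb2 @\<^sub>c 0\<^sub>m n nb3 \<in> carrier_mat n (nb1 + (nb2 + nb3))"
    by (auto intro!: append_cols_carrier)
  moreover have "coupling_matrix n m Ac1 Ac2 Ac3 Gc1 Gc2 Gc3
        \<in> carrier_mat (nc1 + (nc2 + (nc3 + (n + m + n)))) (ng1 + (ng2 + ng3))"
      "coupling_matrix n m Ab1 Ab2 Ab3 Gb1 Gb2 Gb3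
        \<in> carrier_mat (nc1 + (nc2 + (nc3 + (n + m + n)))) (nb1 + (nb2 + nb3))"
    using carriers by (auto intro!: coupling_matrix_carrier)
  moreover have "b1 @\<^sub>v b2 @\<^sub>v b3 @\<^sub>v (c2[1 : n + m]\<^sub>v - c1) @\<^sub>v (c3 - c2[n + m + 1 : 2 * n + m]\<^sub>v)
        \<in> carrier_vec (nc1 + (nc2 + (nc3 + (n + m + n))))"
    using carriers by (intro append_carrier_vec minus_carrier_vec vec_range_carrier) auto
  ultimately show ?thesis
    unfolding hz_format_def by (simp add: vec_range_carrier add.assoc)
qed

text \<open>The factors that represent \<open>(x, u)\<close>, \<open>(x, u, y)\<close> and \<open>y\<close> in the three sets, stacked, satisfy
  the linking rows because both sides of each linking row are representations of the same vector.\<close>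

lemma coupled_hybrid_zonotope_member:
  assumes x: "x \<in> carrier_vec n" and u: "u \<in> carrier_vec m" and y: "y \<in> carrier_vec n"
    and mem1: "x @\<^sub>v u \<in> hybrid_zonotope Gc1 Gb1 c1 Ac1 Ab1 b1"
    and mem2: "x @\<^sub>v u @\<^sub>v y \<in> hybrid_zonotope Gc2 Gb2 c2 Ac2 Ab2 b2"
    and mem3: "y \<in> hybrid_zonotope Gc3 Gb3 c3 Ac3 Ab3 b3"
  shows "x \<in> hybrid_zonotope
     (Gc1[1 : n,:] @\<^sub>c 0\<^sub>m n ng2 @\<^sub>c 0\<^sub>m n ng3) (Gb1[1 : n,:] @\<^sub>c 0\<^sub>m n nb2 @\<^sub>c 0\<^sub>m n nb3) (c1[1 : n]\<^sub>v)
     (coupling_matrix n m Ac1 Ac2 Ac3 Gc1 Gc2 Gc3) (coupling_matrix n m Ab1 Ab2 Ab3 Gb1 Gb2 Gb3)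
     (b1 @\<^sub>v b2 @\<^sub>v b3 @\<^sub>v (c2[1 : n + m]\<^sub>v - c1) @\<^sub>v (c3 - c2[n + m + 1 : 2 * n + m]\<^sub>v))"
proof -
  obtain xc1 xb1 where
    f1: "factor_vec {-1..1} ng1 xc1" "factor_vec {-1, 1} nb1 xb1" "Ac1 *\<^sub>v xc1 + Ab1 *\<^sub>v xb1 = b1"
    and z1: "x @\<^sub>v u = Gc1 *\<^sub>v xc1 + Gb1 *\<^sub>v xb1 + c1"
    using mem1 unfolding hybrid_zonotope_iff[OF format1] by blast
  obtain xc2 xb2 where
    f2: "factor_vec {-1..1} ng2 xc2" "factor_vec {-1, 1} nb2 xb2" "Ac2 *\<^sub>v xc2 + Ab2 *\<^sub>v xb2 = b2"
    and z2: "x @\<^sub>v u @\<^sub>v y = Gc2 *\<^sub>v xc2 + Gb2 *\<^sub>v xb2 + c2"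
    using mem2 unfolding hybrid_zonotope_iff[OF format2] by blast
  obtain xc3 xb3 where
    f3: "factor_vec {-1..1} ng3 xc3" "factor_vec {-1, 1} nb3 xb3" "Ac3 *\<^sub>v xc3 + Ab3 *\<^sub>v xb3 = b3"
    and z3: "y = Gc3 *\<^sub>v xc3 + Gb3 *\<^sub>v xb3 + c3"
    using mem3 unfolding hybrid_zonotope_iff[OF format3] by blast

  have xi: "xc1 \<in> carrier_vec ng1" "xc2 \<in> carrier_vec ng2" "xc3 \<in> carrier_vec ng3"
      "xb1 \<in> carrier_vec nb1" "xb2 \<in> carrier_vec nb2" "xb3 \<in> carrier_vec nb3"
    using f1 f2 f3 by (auto simp: factor_vec_def)
  have p: "Gc1 *\<^sub>v xc1 \<in> carrier_vec (n + m)" "Gb1 *\<^sub>v xb1 \<in> carrier_vec (n + m)"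
      "c1 \<in> carrier_vec (n + m)"
      "Gc2 *\<^sub>v xc2 \<in> carrier_vec (2 * n + m)" "Gb2 *\<^sub>v xb2 \<in> carrier_vec (2 * n + m)"
      "c2 \<in> carrier_vec (2 * n + m)"
      "Gc3 *\<^sub>v xc3 \<in> carrier_vec n" "Gb3 *\<^sub>v xb3 \<in> carrier_vec n" "c3 \<in> carrier_vec n"
    using carriers xi by auto
  have q: "w[1 : n + m]\<^sub>v \<in> carrier_vec (n + m)" "w[n + m + 1 : 2 * n + m]\<^sub>v \<in> carrier_vec n"
    for w :: "real vec"
    by (auto intro!: vec_range_carrier)

  have xu: "x @\<^sub>v u \<in> carrier_vec (n + m)" using x u by simp
  have "x @\<^sub>v u = (x @\<^sub>v u @\<^sub>v y)[1 : n + m]\<^sub>v"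
    using vec_range_append_first[OF xu] by (simp add: append_vec_assoc)
  also have "\<dots> = (Gc2 *\<^sub>v xc2)[1 : n + m]\<^sub>v + (Gb2 *\<^sub>v xb2)[1 : n + m]\<^sub>v + c2[1 : n + m]\<^sub>v"
    unfolding z2 by (rule vec_range_add3[OF p(4-6)]) simp
  finally have link_xu: "(Gc1 *\<^sub>v xc1 - (Gc2 *\<^sub>v xc2)[1 : n + m]\<^sub>v)
      + (Gb1 *\<^sub>v xb1 - (Gb2 *\<^sub>v xb2)[1 : n + m]\<^sub>v) = c2[1 : n + m]\<^sub>v - c1"
    using p q by (intro affine_images_agree[of _ "n + m"]) (auto simp: z1)

  have "(x @\<^sub>v u @\<^sub>v y)[n + m + 1 : 2 * n + m]\<^sub>v = y"
    using vec_range_append_last[OF xu, of y "2 * n + m"] y by (simp add: append_vec_assoc)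
  moreover have "(x @\<^sub>v u @\<^sub>v y)[n + m + 1 : 2 * n + m]\<^sub>v =
      (Gc2 *\<^sub>v xc2)[n + m + 1 : 2 * n + m]\<^sub>v + (Gb2 *\<^sub>v xb2)[n + m + 1 : 2 * n + m]\<^sub>v
      + c2[n + m + 1 : 2 * n + m]\<^sub>v"
    unfolding z2 by (rule vec_range_add3[OF p(4-6)]) simp
  ultimately have link_y: "((Gc2 *\<^sub>v xc2)[n + m + 1 : 2 * n + m]\<^sub>v - Gc3 *\<^sub>v xc3)
      + ((Gb2 *\<^sub>v xb2)[n + m + 1 : 2 * n + m]\<^sub>v - Gb3 *\<^sub>v xb3)
      = c3 - c2[n + m + 1 : 2 * n + m]\<^sub>v"
    by (intro affine_images_agree[of _ n] p q) (simp add: z3)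

  let ?xc = "xc1 @\<^sub>v xc2 @\<^sub>v xc3" and ?xb = "xb1 @\<^sub>v xb2 @\<^sub>v xb3"
  have multc: "coupling_matrix n m Ac1 Ac2 Ac3 Gc1 Gc2 Gc3 *\<^sub>v ?xc =
      Ac1 *\<^sub>v xc1 @\<^sub>v Ac2 *\<^sub>v xc2 @\<^sub>v Ac3 *\<^sub>v xc3 @\<^sub>v
      (Gc1 *\<^sub>v xc1 - (Gc2 *\<^sub>v xc2)[1 : n + m]\<^sub>v) @\<^sub>v
      ((Gc2 *\<^sub>v xc2)[n + m + 1 : 2 * n + m]\<^sub>v - Gc3 *\<^sub>v xc3)"
    using carriers xi by (intro coupling_matrix_mult_vec) auto
  have multb: "coupling_matrix n m Ab1 Ab2 Ab3 Gb1 Gb2 Gb3 *\<^sub>v ?xb =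
      Ab1 *\<^sub>v xb1 @\<^sub>v Ab2 *\<^sub>v xb2 @\<^sub>v Ab3 *\<^sub>v xb3 @\<^sub>v
      (Gb1 *\<^sub>v xb1 - (Gb2 *\<^sub>v xb2)[1 : n + m]\<^sub>v) @\<^sub>v
      ((Gb2 *\<^sub>v xb2)[n + m + 1 : 2 * n + m]\<^sub>v - Gb3 *\<^sub>v xb3)"
    using carriers xi by (intro coupling_matrix_mult_vec) auto
  have a: "Ac1 *\<^sub>v xc1 \<in> carrier_vec nc1" "Ab1 *\<^sub>v xb1 \<in> carrier_vec nc1"
      "Ac2 *\<^sub>v xc2 \<in> carrier_vec nc2" "Ab2 *\<^sub>v xb2 \<in> carrier_vec nc2"
      "Ac3 *\<^sub>v xc3 \<in> carrier_vec nc3" "Ab3 *\<^sub>v xb3 \<in> carrier_vec nc3"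
    using carriers xi by auto
  \<comment> \<open>Addition distributes over stacking only when the dimensions of the two parts match, so the
    blocks are split off one at a time with the dimension of the remaining stack made explicit.\<close>
  have constraint: "coupling_matrix n m Ac1 Ac2 Ac3 Gc1 Gc2 Gc3 *\<^sub>v ?xc
      + coupling_matrix n m Ab1 Ab2 Ab3 Gb1 Gb2 Gb3 *\<^sub>v ?xb
      = b1 @\<^sub>v b2 @\<^sub>v b3 @\<^sub>v (c2[1 : n + m]\<^sub>v - c1) @\<^sub>v (c3 - c2[n + m + 1 : 2 * n + m]\<^sub>v)"
    unfolding multc multb
    unfolding f1(3)[symmetric] f2(3)[symmetric] f3(3)[symmetric]
      link_xu[symmetric] link_y[symmetric]
    using a p q
    by (subst append_vec_add[of _ nc1 _ _ "nc2 + (nc3 + (n + m + n))"],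
        (auto intro!: append_carrier_vec)[4],
        subst append_vec_add[of _ nc2 _ _ "nc3 + (n + m + n)"],
        (auto intro!: append_carrier_vec)[4],
        subst append_vec_add[of _ nc3 _ _ "n + m + n"],
        (auto intro!: append_carrier_vec)[4],
        subst append_vec_add[of _ "n + m" _ _ n], auto)

  have read: "(G[1 : n,:] @\<^sub>c 0\<^sub>m n k2 @\<^sub>c 0\<^sub>m n k3) *\<^sub>v (v1 @\<^sub>v v2 @\<^sub>v v3) = (G *\<^sub>v v1)[1 : n]\<^sub>v"
    if "G \<in> carrier_mat (n + m) k1"
      "v1 \<in> carrier_vec k1" "v2 \<in> carrier_vec k2" "v3 \<in> carrier_vec k3"
    for G :: "real mat" and k1 k2 k3 v1 v2 v3
  proof -
    have "G[1 : n,:] \<in> carrier_mat n k1" using that(1) by (rule row_range_carrier) auto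
    then show ?thesis
      using that by (simp add: append_cols3_mult_vec[of _ n k1 _ k2 _ k3] zero_mat_mult_vec
          row_range_mult_vec[of _ "n + m"] vec_range_carrier)
  qed
  have readc: "(Gc1[1 : n,:] @\<^sub>c 0\<^sub>m n ng2 @\<^sub>c 0\<^sub>m n ng3) *\<^sub>v ?xc = (Gc1 *\<^sub>v xc1)[1 : n]\<^sub>v"
    using carriers by (intro read[OF _ xi(1-3)]) simp
  have readb: "(Gb1[1 : n,:] @\<^sub>c 0\<^sub>m n nb2 @\<^sub>c 0\<^sub>m n nb3) *\<^sub>v ?xb = (Gb1 *\<^sub>v xb1)[1 : n]\<^sub>v"
    using carriers by (intro read[OF _ xi(4-6)]) simp
  have "x = (x @\<^sub>v u)[1 : n]\<^sub>v" using vec_range_append_first[OF x] by simp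
  also have "\<dots> = (Gc1 *\<^sub>v xc1)[1 : n]\<^sub>v + (Gb1 *\<^sub>v xb1)[1 : n]\<^sub>v + c1[1 : n]\<^sub>v"
    unfolding z1 by (rule vec_range_add3[OF p(1-3)]) simp
  also have "\<dots> = (Gc1[1 : n,:] @\<^sub>c 0\<^sub>m n ng2 @\<^sub>c 0\<^sub>m n ng3) *\<^sub>v ?xc
      + (Gb1[1 : n,:] @\<^sub>c 0\<^sub>m n nb2 @\<^sub>c 0\<^sub>m n nb3) *\<^sub>v ?xb + c1[1 : n]\<^sub>v"
    by (simp only: readc readb)
  finally have state: "x = (Gc1[1 : n,:] @\<^sub>c 0\<^sub>m n ng2 @\<^sub>c 0\<^sub>m n ng3) *\<^sub>v ?xc
      + (Gb1[1 : n,:] @\<^sub>c 0\<^sub>m n nb2 @\<^sub>c 0\<^sub>m n nb3) *\<^sub>v ?xb + c1[1 : n]\<^sub>v" .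

  have "factor_vec {-1..1} (ng1 + ng2 + ng3) ?xc" "factor_vec {-1, 1} (nb1 + nb2 + nb3) ?xb"
    using f1 f2 f3 by (simp_all add: add.assoc factor_vec_append)
  then show ?thesis
    unfolding hybrid_zonotope_iff[OF coupled_hybrid_zonotope_format]
    using constraint state by blast
qed

end

section \<open>Backward reachability\<close>

lemma hybrid_zonotope_carrier: "is_hybrid_zonotope d S \<Longrightarrow> S \<subseteq> carrier_vec d"
  unfolding is_hybrid_zonotope_def hz_format_def hybrid_zonotope_def by fastforce

text \<open>The prior sets may be smaller than \<open>X\<close> and \<open>U\<close>, but the hypothesis on them concerns exactly the
  pairs \<open>(x, \<pi> x)\<close> with \<open>x\<close> backward reachable: the selection matrix \<open>[I 0]\<close> maps such a pair to \<open>x\<close>.\<close>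

lemma backward_reach_in_prior:
  assumes "x \<in> backward_reach X f \<pi> T" and x: "x \<in> carrier_vec n" and u: "\<pi> x \<in> carrier_vec m"
    and prior: "Xp \<subseteq> carrier_vec n"
      "gen_inter (1\<^sub>m n @\<^sub>c 0\<^sub>m n m) (policy_graph \<pi> X) (backward_reach X f \<pi> T) \<subseteq> Xp \<times>\<^sub>v Up"
  shows "x \<in> Xp \<and> \<pi> x \<in> Up"
proof -
  have "(1\<^sub>m n @\<^sub>c 0\<^sub>m n m) *\<^sub>v (x @\<^sub>v \<pi> x) = x"
    using x u by (simp add: append_cols_mult_vec[of _ n n _ m] zero_mat_mult_vec)
  moreover have "x @\<^sub>v \<pi> x \<in> policy_graph \<pi> X"
    using assms(1) by (auto simp: backward_reach_def policy_graph_def)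
  ultimately have "x @\<^sub>v \<pi> x \<in> Xp \<times>\<^sub>v Up"
    using assms(1) prior(2) by (auto simp: gen_inter_def)
  then obtain x' u' where *: "x' \<in> Xp" "u' \<in> Up" "x @\<^sub>v \<pi> x = x' @\<^sub>v u'"
    by (auto simp: vec_times_def)
  then have "x = x' \<and> \<pi> x = u'"
    using append_vec_eq[OF x] prior(1) by blast
  with * show ?thesis by metis
qed

theorem theorem3:
  fixes n m :: nat
    and X U Xp Up T H\<pi> H\<pi>_bar Hf_bar :: "real vec set"
    and f :: "real vec \<Rightarrow> real vec \<Rightarrow> real vec"
    and \<pi> :: "real vec \<Rightarrow> real vec"
    and \<sigma> :: "real \<Rightarrow> real" and l :: nat and N :: "nat \<Rightarrow> nat"
    and W :: "nat \<Rightarrow> real mat" and v :: "nat \<Rightarrow> real vec"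
    and ng\<tau> nb\<tau> nc\<tau> ng\<pi> nb\<pi> nc\<pi> ngf nbf ncf :: nat
    and Gc\<tau> Gb\<tau> Ac\<tau> Ab\<tau> Gc\<pi> Gb\<pi> Ac\<pi> Ab\<pi> Gcf Gbf Acf Abf :: "real mat"
    and c\<tau> b\<tau> c\<pi> b\<pi> cf bf :: "real vec"
  assumes X: "is_hybrid_zonotope n X"
    and U: "is_hybrid_zonotope m U"
    and f: "\<And>x u. x \<in> X \<Longrightarrow> u \<in> U \<Longrightarrow> f x u \<in> carrier_vec n"
    and nn: "ffnn_format n m l N W v" "\<pi> = ffnn \<sigma> l W v" "\<not> piecewise_linear \<sigma>"
    and \<pi>: "\<And>x. x \<in> X \<Longrightarrow> \<pi> x \<in> U"
    and T: "hz_format n ng\<tau> nb\<tau> nc\<tau> Gc\<tau> Gb\<tau> c\<tau> Ac\<tau> Ab\<tau> b\<tau>"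
      "T = hybrid_zonotope Gc\<tau> Gb\<tau> c\<tau> Ac\<tau> Ab\<tau> b\<tau>"
    and H\<pi>: "H\<pi> = policy_graph \<pi> X"
    and H\<pi>_bar: "hz_format (n + m) ng\<pi> nb\<pi> nc\<pi> Gc\<pi> Gb\<pi> c\<pi> Ac\<pi> Ab\<pi> b\<pi>"
      "H\<pi>_bar = hybrid_zonotope Gc\<pi> Gb\<pi> c\<pi> Ac\<pi> Ab\<pi> b\<pi>"
      "H\<pi> \<subseteq> H\<pi>_bar"
    and prior: "Xp \<subseteq> carrier_vec n" "Up \<subseteq> carrier_vec m"
      "gen_inter (1\<^sub>m n @\<^sub>c 0\<^sub>m n m) H\<pi> (backward_reach X f \<pi> T) \<subseteq> Xp \<times>\<^sub>v Up"
      "Xp \<times>\<^sub>v Up \<subseteq> X \<times>\<^sub>v U"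
    and Hf_bar: "hz_format (2 * n + m) ngf nbf ncf Gcf Gbf cf Acf Abf bf"
      "Hf_bar = hybrid_zonotope Gcf Gbf cf Acf Abf bf"
      "dynamics_graph f Xp Up \<subseteq> Hf_bar"
  shows
    "let
       cp = c\<pi>[1 : n]\<^sub>v;
       Gcp = Gc\<pi>[1 : n,:] @\<^sub>c 0\<^sub>m n ngf @\<^sub>c 0\<^sub>m n ng\<tau>;
       Gbp = Gb\<pi>[1 : n,:] @\<^sub>c 0\<^sub>m n nbf @\<^sub>c 0\<^sub>m n nb\<tau>;
       Acp =
         (Ac\<pi>            @\<^sub>c 0\<^sub>m nc\<pi> ngf                      @\<^sub>c 0\<^sub>m nc\<pi> ng\<tau>) @\<^sub>r
         (0\<^sub>m ncf ng\<pi>    @\<^sub>c Acf                             @\<^sub>c 0\<^sub>m ncf ng\<tau>) @\<^sub>r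
         (0\<^sub>m nc\<tau> ng\<pi>    @\<^sub>c 0\<^sub>m nc\<tau> ngf                      @\<^sub>c Ac\<tau>) @\<^sub>r
         (Gc\<pi>            @\<^sub>c (- Gcf[1 : n + m,:])             @\<^sub>c 0\<^sub>m (n + m) ng\<tau>) @\<^sub>r
         (0\<^sub>m n ng\<pi>      @\<^sub>c Gcf[n + m + 1 : 2 * n + m,:]     @\<^sub>c (- Gc\<tau>));
       Abp =
         (Ab\<pi>            @\<^sub>c 0\<^sub>m nc\<pi> nbf                      @\<^sub>c 0\<^sub>m nc\<pi> nb\<tau>) @\<^sub>r
         (0\<^sub>m ncf nb\<pi>    @\<^sub>c Abf                             @\<^sub>c 0\<^sub>m ncf nb\<tau>) @\<^sub>r
         (0\<^sub>m nc\<tau> nb\<pi>    @\<^sub>c 0\<^sub>m nc\<tau> nbf                      @\<^sub>c Ab\<tau>) @\<^sub>r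
         (Gb\<pi>            @\<^sub>c (- Gbf[1 : n + m,:])             @\<^sub>c 0\<^sub>m (n + m) nb\<tau>) @\<^sub>r
         (0\<^sub>m n nb\<pi>      @\<^sub>c Gbf[n + m + 1 : 2 * n + m,:]     @\<^sub>c (- Gb\<tau>));
       bp = b\<pi> @\<^sub>v bf @\<^sub>v b\<tau> @\<^sub>v (cf[1 : n + m]\<^sub>v - c\<pi>) @\<^sub>v
            (c\<tau> - cf[n + m + 1 : 2 * n + m]\<^sub>v)
     in hz_format n (ng\<pi> + ngf + ng\<tau>) (nb\<pi> + nbf + nb\<tau>) (nc\<pi> + ncf + nc\<tau> + (n + m) + n)
          Gcp Gbp cp Acp Abp bp \<and>
        backward_reach X f \<pi> T \<subseteq> hybrid_zonotope Gcp Gbp cp Acp Abp bp"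
proof -
  have over: "backward_reach X f \<pi> T \<subseteq> hybrid_zonotope
     (Gc\<pi>[1 : n,:] @\<^sub>c 0\<^sub>m n ngf @\<^sub>c 0\<^sub>m n ng\<tau>) (Gb\<pi>[1 : n,:] @\<^sub>c 0\<^sub>m n nbf @\<^sub>c 0\<^sub>m n nb\<tau>) (c\<pi>[1 : n]\<^sub>v)
     (coupling_matrix n m Ac\<pi> Acf Ac\<tau> Gc\<pi> Gcf Gc\<tau>) (coupling_matrix n m Ab\<pi> Abf Ab\<tau> Gb\<pi> Gbf Gb\<tau>)
     (b\<pi> @\<^sub>v bf @\<^sub>v b\<tau> @\<^sub>v (cf[1 : n + m]\<^sub>v - c\<pi>) @\<^sub>v (c\<tau> - cf[n + m + 1 : 2 * n + m]\<^sub>v))"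
  proof
    fix x assume x: "x \<in> backward_reach X f \<pi> T"
    then have xX: "x \<in> X" and yT: "f x (\<pi> x) \<in> T" by (auto simp: backward_reach_def)
    have carr: "x \<in> carrier_vec n" "\<pi> x \<in> carrier_vec m" "f x (\<pi> x) \<in> carrier_vec n"
      using hybrid_zonotope_carrier[OF X] hybrid_zonotope_carrier[OF U] xX \<pi>[OF xX] f by auto
    have "x \<in> Xp \<and> \<pi> x \<in> Up"
      using prior(3) unfolding H\<pi> by (intro backward_reach_in_prior[OF x carr(1,2) prior(1)])
    then have "x @\<^sub>v \<pi> x @\<^sub>v f x (\<pi> x) \<in> Hf_bar"
      using Hf_bar(3) by (auto simp: dynamics_graph_def)
    moreover have "x @\<^sub>v \<pi> x \<in> H\<pi>_bar"
      using H\<pi>_bar(3) xX unfolding H\<pi> by (auto simp: policy_graph_def)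
    ultimately show "x \<in> hybrid_zonotope
     (Gc\<pi>[1 : n,:] @\<^sub>c 0\<^sub>m n ngf @\<^sub>c 0\<^sub>m n ng\<tau>) (Gb\<pi>[1 : n,:] @\<^sub>c 0\<^sub>m n nbf @\<^sub>c 0\<^sub>m n nb\<tau>) (c\<pi>[1 : n]\<^sub>v)
     (coupling_matrix n m Ac\<pi> Acf Ac\<tau> Gc\<pi> Gcf Gc\<tau>) (coupling_matrix n m Ab\<pi> Abf Ab\<tau> Gb\<pi> Gbf Gb\<tau>)
     (b\<pi> @\<^sub>v bf @\<^sub>v b\<tau> @\<^sub>v (cf[1 : n + m]\<^sub>v - c\<pi>) @\<^sub>v (c\<tau> - cf[n + m + 1 : 2 * n + m]\<^sub>v))"
      using yT unfolding H\<pi>_bar(2) Hf_bar(2) T(2)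
      by (intro coupled_hybrid_zonotope_member[OF H\<pi>_bar(1) Hf_bar(1) T(1) carr])
  qed
  have dims: "dim_row Ac\<pi> = nc\<pi>" "dim_col Ac\<pi> = ng\<pi>" "dim_row Ab\<pi> = nc\<pi>" "dim_col Ab\<pi> = nb\<pi>"
      "dim_row Acf = ncf" "dim_col Acf = ngf" "dim_row Abf = ncf" "dim_col Abf = nbf"
      "dim_row Ac\<tau> = nc\<tau>" "dim_col Ac\<tau> = ng\<tau>" "dim_row Ab\<tau> = nc\<tau>" "dim_col Ab\<tau> = nb\<tau>"
    using T(1) H\<pi>_bar(1) Hf_bar(1) by (auto simp: hz_format_def)
  show ?thesis
    using over coupled_hybrid_zonotope_format[OF H\<pi>_bar(1) Hf_bar(1) T(1)]
    unfolding Let_def coupling_matrix_def dims by (rule conjI[rotated])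
qed

end
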